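(* There exists a pairwise independent random graph $\{\mathcal G^2(N,1/2)\}_N$ (i.e. $k=2$ and $p=1/2$) such that (i) with probability tending to $1$ as $N\to\infty$ the graph is disconnected (and in particular contains no Hamiltonian cycle), and (ii) for every $N$ the graph contains no perfect matching with probability $1$.
   Context: A $k$-wise independent random graph $\{\mathcal G^k(N,p)\}_N$ is a sequence, indexed by $N$, of probability distributions on simple undirected graphs with vertex set $\{1,\dots,N\}$ such that every potential edge appears with probability $p(N)$ and the indicator random variables of the appearance of any $k(N)$ potential edges are mutually independent; pairwise independent means $k=2$.
   Formalization: Claim (ii) is proved for every N ≥ 1 except N = 2 and N = 4, where it is false: with pairwise independence and p = 1/2 a perfect matching appears with probability at least 1/2 and 1/4 respectively. *)

theory Defs
  imports "HOL-Probability.Probability" "Graph_Theory.Graph_Theory"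
begin

(* A simple undirected graph is a pair_graph: a finite loop-free digraph without parallel arcs
   whose arc relation is symmetric. The undirected edge {u, v} is the pair of arcs (u, v), (v, u). *)

definition edges :: "'a pair_pre_digraph \<Rightarrow> 'a set set" where
  "edges H = {{u, v} | u v. (u, v) \<in> parcs H}"

definition potential_edges :: "nat \<Rightarrow> nat set set" where
  "potential_edges N = {e. e \<subseteq> {1..N} \<and> card e = 2}"

(* There are only finitely many graphs on {1..N}, so every distribution on them is a pmf. *)

definition kwise_independent_random_graph ::
    "(nat \<Rightarrow> nat) \<Rightarrow> (nat \<Rightarrow> real) \<Rightarrow> (nat \<Rightarrow> nat pair_pre_digraph pmf) \<Rightarrow> bool" where
  "kwise_independent_random_graph k p G \<longleftrightarrow>
     (\<forall>N\<ge>1.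
        (\<forall>H\<in>set_pmf (G N). pair_graph H \<and> pverts H = {1..N}) \<and>
        (\<forall>e\<in>potential_edges N. measure_pmf.prob (G N) {H. e \<in> edges H} = p N) \<and>
        (\<forall>S. S \<subseteq> potential_edges N \<and> card S = k N \<longrightarrow>
           prob_space.indep_vars (measure_pmf (G N)) (\<lambda>_. count_space (UNIV :: bool set))
             (\<lambda>e H. e \<in> edges H) S))"

definition has_perfect_matching :: "'a pair_pre_digraph \<Rightarrow> bool" where
  "has_perfect_matching H \<longleftrightarrow> (\<exists>M. M \<subseteq> edges H \<and> disjoint M \<and> \<Union>M = pverts H)"

(* The library's cycle allows the digraph cycle u, v, u; an undirected cycle has length at least 3. *)

definition has_hamiltonian_cycle :: "'a pair_pre_digraph \<Rightarrow> bool" where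
  "has_hamiltonian_cycle H \<longleftrightarrow>
     (\<exists>c. pre_digraph.cycle (with_proj H) c \<and> length c \<ge> 3 \<and> fst ` set c = pverts H)"

(* For N = 2 and N = 4 a perfect matching cannot be avoided: it consists of at most two
   edges, which pairwise independence makes appear together with positive probability. *)

lemma perfect_matching_unavoidable:
  assumes G: "kwise_independent_random_graph (\<lambda>_. 2) (\<lambda>_. 1/2) G" and N: "N \<in> {2, 4}"
  shows "measure_pmf.prob (G N) {H. \<not> has_perfect_matching H} < 1"
proof -
  let ?P = "measure_pmf.prob (G N)"
  have "N \<ge> 1" using N by auto
  note G' = G[unfolded kwise_independent_random_graph_def, rule_format, OF this]
  have V: "pverts H = {1..N}" if "H \<in> set_pmf (G N)" for H
    using G' that by blast
  have p: "?P {H. e \<in> edges H} = 1/2" if "e \<in> potential_edges N" for e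
    using G' that by blast
  obtain M where M: "disjoint M" "\<Union>M = {1..N}" "?P {H. M \<subseteq> edges H} > 0"
  proof (cases "N = 2")
    case True
    have v: "{1..N} = {1, 2}" using True by auto
    then have "{1, 2} \<in> potential_edges N" by (simp add: potential_edges_def)
    then have "?P {H. {1, 2} \<in> edges H} > 0" by (simp only: p)
    then show thesis using that[of "{{1, 2}}"] v by simp
  next
    case False
    then have N4: "N = 4" using N by simp
    then have v: "{1..N} = {1, 2, 3, 4}" by auto
    let ?S = "{{1, 2}, {3, 4}} :: nat set set"
    have ne: "{1, 2} \<noteq> {3, 4 :: nat}" by (simp add: doubleton_eq_iff)
    have S: "?S \<subseteq> potential_edges N" "card ?S = 2"
      using ne N4 by (simp_all add: potential_edges_def)
    define A where "A e = {H :: nat pair_pre_digraph. e \<in> edges H}" for e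
    have pre: "(\<lambda>H. e \<in> edges H) -` {True} \<inter> space (measure_pmf (G N)) = A e" for e
      by (auto simp: A_def)
    have ind: "prob_space.indep_vars (measure_pmf (G N)) (\<lambda>_. count_space (UNIV :: bool set))
             (\<lambda>e H. e \<in> edges H) ?S"
      using G' S by blast
    have "?P (\<Inter>e\<in>?S. A e) = (\<Prod>e\<in>?S. ?P (A e))"
      using prob_space.indep_varsD[OF measure_pmf.prob_space_axioms ind, of ?S "\<lambda>_. {True}"]
      unfolding pre by simp
    moreover have "(\<Inter>e\<in>?S. A e) = {H. ?S \<subseteq> edges H}"
      unfolding A_def by blast
    moreover have "(\<Prod>e\<in>?S. ?P (A e)) > 0"
    proof (rule prod_pos)
      fix e assume "e \<in> ?S"
      then have "?P (A e) = 1/2" unfolding A_def using S(1) p by blast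
      then show "?P (A e) > 0" by simp
    qed
    ultimately have "?P {H. ?S \<subseteq> edges H} > 0" by metis
    moreover have "disjoint ?S" by (simp add: pairwise_def disjnt_def)
    moreover have "\<Union>?S = {1..N}" unfolding v by blast
    ultimately show thesis using that by blast
  qed
  have "?P {H. M \<subseteq> edges H} \<le> ?P {H. has_perfect_matching H}"
  proof (rule measure_pmf.finite_measure_mono_AE)
    show "AE H in measure_pmf (G N). H \<in> {H. M \<subseteq> edges H} \<longrightarrow> H \<in> {H. has_perfect_matching H}"
      using M V by (auto simp: AE_measure_pmf_iff has_perfect_matching_def)
  qed simp
  moreover have "?P {H. \<not> has_perfect_matching H} = 1 - ?P {H. has_perfect_matching H}"
    using measure_pmf.prob_compl[of "{H. has_perfect_matching H}" "G N"]
    by (simp add: Compl_eq_Diff_UNIV[symmetric] Collect_neg_eq)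
  ultimately show ?thesis using M(3) by simp
qed

end

(* Cut the vertex set at random into two parts and let the graph consist of the complete graphs on
   them. Whether an edge is present depends on the parity of its intersection with one part A, so
   exchanging the sides of a set T of vertices flips the edges that meet T in one vertex and fixes
   those disjoint from T. Given two distinct edges, a vertex of the first outside the second flips
   the first only; hence uniform cuts make the edges pairwise independent. For even N >= 6 only cuts
   into two odd parts are used: a perfect matching would have to match each part within itself. The
   flip then moves a further vertex outside both edges, to keep the parity. *)
theory Submission
  imports Defs "HOL-Real_Asymp.Real_Asymp"
begin

section \<open>Consequences of Hamiltonian cycles and perfect matchings\<close>

lemma hamiltonian_cycle_imp_connected:
  assumes "pair_graph H" "has_hamiltonian_cycle H"
  shows "Digraph_Component.connected (with_proj H)"
proof -
  interpret pair_graph H by fact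
  obtain c u where c: "awalk u c u" "c \<noteq> []" "fst ` set c = pverts H"
    using assms(2) unfolding has_hamiltonian_cycle_def cycle_def by auto
  \<comment> \<open>Every vertex lies on the closed walk \<open>c\<close>, hence is reachable from
    its start \<open>u\<close> and reaches \<open>u\<close> again.\<close>
  have reach: "u \<rightarrow>\<^sup>*\<^bsub>with_proj H\<^esub> v \<and> v \<rightarrow>\<^sup>*\<^bsub>with_proj H\<^esub> u" if "v \<in> pverts H" for v
  proof -
    have "v \<in> set (awalk_verts u c)"
      using that c by (auto simp: set_awalk_verts)
    then show ?thesis
      using awalk_verts_reachable_from[OF c(1)] awalk_verts_reachable_to[OF c(1)] by blast
  qed
  have "pverts H \<noteq> {}"
    using c by auto
  moreover have "v \<rightarrow>\<^sup>*\<^bsub>with_proj (mk_symmetric H)\<^esub> w" if "v \<in> pverts H" "w \<in> pverts H" for v w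
    using reach that by (blast intro: reachable_trans reachable_mk_symmetricI)
  ultimately show ?thesis
    by (auto simp: connected_def strongly_connected_def)
qed

lemma even_card_Union_of_pairs:
  assumes "disjoint M" "\<And>e. e \<in> M \<Longrightarrow> card e = 2"
  shows "even (card (\<Union>M))"
proof -
  have "finite e" if "e \<in> M" for e
    using assms(2)[OF that] by (intro card_ge_0_finite) simp
  then have "card (\<Union>M) = sum card M"
    using assms(1) by (intro card_Union_disjoint) (auto simp: pairwise_def disjnt_def)
  then show ?thesis
    using assms(2) by (auto intro!: dvd_sum)
qed

section \<open>Probabilities under a flip, and independence of two events\<close>

text \<open>The map \<open>t\<close> preserves the distribution and exchanges the events
  \<open>P \<and> Q\<close> and \<open>\<not> P \<and> Q\<close>, so these two halves of
  \<open>Q\<close> are equally likely.\<close>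

lemma prob_flip:
  fixes p :: "'a pmf"
  assumes inv: "map_pmf t p = p"
    and P: "\<And>x. x \<in> set_pmf p \<Longrightarrow> P (t x) \<longleftrightarrow> \<not> P x"
    and Q: "\<And>x. x \<in> set_pmf p \<Longrightarrow> Q (t x) \<longleftrightarrow> Q x"
  shows "measure_pmf.prob p {x. P x \<and> Q x} = measure_pmf.prob p {x. Q x} / 2"
proof -
  have "measure_pmf.prob p {x. P x \<and> Q x} = measure_pmf.prob (map_pmf t p) {x. P x \<and> Q x}"
    by (simp only: inv)
  also have "\<dots> = measure_pmf.prob p {x. P (t x) \<and> Q (t x)}"
    by (simp add: vimage_def)
  also have "\<dots> = measure_pmf.prob p {x. \<not> P x \<and> Q x}"
    using P Q by (intro measure_pmf.finite_measure_eq_AE) (auto simp: AE_measure_pmf_iff)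
  finally have "measure_pmf.prob p {x. P x \<and> Q x} = measure_pmf.prob p {x. \<not> P x \<and> Q x}" .
  moreover have "measure_pmf.prob p {x. Q x} =
      measure_pmf.prob p ({x. P x \<and> Q x} \<union> {x. \<not> P x \<and> Q x})"
    by (rule arg_cong[where f = "measure_pmf.prob p"]) auto
  moreover have "\<dots> = measure_pmf.prob p {x. P x \<and> Q x} + measure_pmf.prob p {x. \<not> P x \<and> Q x}"
    by (rule measure_pmf.finite_measure_Union) auto
  ultimately show ?thesis by simp
qed

text \<open>The intersection-stable family \<open>?E\<close> generates all sets of truth values, so
  the product rule need only be checked on \<open>?E\<close>. There the only nontrivial case is
  \<open>{True}\<close> for both variables, which is the assumption.\<close>

lemma indep_vars_bool_pairI:
  assumes "i \<noteq> j"
    and "measure_pmf.prob p {x. X i x \<and> X j x} =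
      measure_pmf.prob p {x. X i x} * measure_pmf.prob p {x. X j x}"
  shows "prob_space.indep_vars (measure_pmf p) (\<lambda>_. count_space (UNIV :: bool set)) X {i, j}"
proof -
  let ?E = "{{True}, UNIV, {}} :: bool set set"
  have "A \<in> sigma_sets UNIV ?E" for A :: "bool set"
  proof -
    have T: "{True} \<in> sigma_sets UNIV ?E" by (rule sigma_sets.Basic) simp
    have "UNIV - {True} \<in> sigma_sets UNIV ?E" by (rule sigma_sets.Compl[OF T])
    moreover have "UNIV - {True} = {False}" by auto
    moreover have "A \<in> Pow {False, True}"
      by auto
    then have "A \<in> {{True}, UNIV, {}, {False}}"
      by (auto simp: Pow_insert UNIV_bool)
    ultimately show ?thesis using T by (auto intro: sigma_sets.Basic)
  qed
  then have "sets (count_space UNIV) = sigma_sets (space (count_space UNIV)) ?E"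
    by auto
  then have "prob_space.indep_vars (measure_pmf p) (\<lambda>_. count_space UNIV) X {i, j} \<longleftrightarrow>
    (\<forall>A\<in>(\<Pi> k\<in>{i, j}. ?E). measure_pmf.prob p (\<Inter>k\<in>{i, j}. X k -` A k \<inter> space p) =
       (\<Prod>k\<in>{i, j}. measure_pmf.prob p (X k -` A k \<inter> space p)))"
    by (intro prob_space.indep_vars_finite[OF prob_space_measure_pmf]) (auto simp: Int_stable_def)
  moreover have "measure_pmf.prob p (X i -` B \<inter> X j -` C) =
      measure_pmf.prob p (X i -` B) * measure_pmf.prob p (X j -` C)" if "B \<in> ?E" "C \<in> ?E" for B C
    using that assms(2) by (auto simp: vimage_def Int_def measure_pmf.prob_space[simplified])
  ultimately show ?thesis
    using assms(1) by (auto simp: Pi_iff)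
qed

section \<open>The graph of a cut\<close>

definition two_cliques :: "nat \<Rightarrow> nat set \<Rightarrow> nat pair_pre_digraph" where
  "two_cliques N A =
     \<lparr>pverts = {1..N}, parcs = {(u, v). u \<in> {1..N} \<and> v \<in> {1..N} \<and> u \<noteq> v \<and> (u \<in> A \<longleftrightarrow> v \<in> A)}\<rparr>"

lemma pverts_two_cliques [simp]: "pverts (two_cliques N A) = {1..N}"
  by (simp add: two_cliques_def)

lemma pair_graph_two_cliques: "pair_graph (two_cliques N A)"
proof
  show "finite (parcs (two_cliques N A))"
    by (rule finite_subset[of _ "{1..N} \<times> {1..N}"]) (auto simp: two_cliques_def)
  show "symmetric (with_proj (two_cliques N A))"
    by (auto simp: symmetric_def sym_def two_cliques_def)
qed (auto simp: two_cliques_def)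

lemma edges_two_cliques_iff:
  assumes "e \<in> potential_edges N"
  shows "e \<in> edges (two_cliques N A) \<longleftrightarrow> e \<subseteq> A \<or> e \<inter> A = {}"
proof -
  obtain u v where "e = {u, v}" "u \<noteq> v"
    using assms by (auto simp: potential_edges_def card_2_iff)
  then show ?thesis
    using assms by (auto simp: edges_def two_cliques_def potential_edges_def doubleton_eq_iff)
qed

lemma edges_two_cliques_subset: "edges (two_cliques N A) \<subseteq> potential_edges N"
  by (auto simp: edges_def two_cliques_def potential_edges_def)

text \<open>No arc leaves \<open>A\<close>, so everything reachable from a vertex of
  \<open>A\<close> stays in \<open>A\<close>.\<close>

lemma not_connected_two_cliques:
  assumes "A \<subseteq> {1..N}" "A \<noteq> {}" "A \<noteq> {1..N}"
  shows "\<not> Digraph_Component.connected (with_proj (two_cliques N A))"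
proof
  assume conn: "Digraph_Component.connected (with_proj (two_cliques N A))"
  obtain u v where uv: "u \<in> A" "v \<in> {1..N}" "v \<notin> A" "u \<in> {1..N}"
    using assms by blast
  interpret pair_graph "two_cliques N A" by (rule pair_graph_two_cliques)
  \<comment> \<open>Connectedness refers to the symmetric closure; since the arcs are already
    symmetric, it yields a directed path.\<close>
  have "u \<rightarrow>\<^sup>*\<^bsub>with_proj (two_cliques N A)\<^esub> v"
    using symmetric_connected_imp_strongly_connected[OF pair_sym_arcs conn] uv
    by (auto simp: strongly_connected_def)
  then have "v \<in> A"
  proof (induction rule: reachable_induct)
    case base
    show ?case by fact
  next
    case (step x y)
    then show ?case by (auto simp: two_cliques_def)
  qed
  then show False using uv by blast
qed

text \<open>In a perfect matching, the edges inside \<open>A\<close> would partition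
  \<open>A\<close> into pairs, and all edges together would partition \<open>{1..N}\<close> into
  pairs. Hence both sizes would be even.\<close>

lemma no_perfect_matching_two_cliques:
  assumes "A \<subseteq> {1..N}" "odd (card A) \<or> odd N"
  shows "\<not> has_perfect_matching (two_cliques N A)"
proof
  assume "has_perfect_matching (two_cliques N A)"
  then obtain M where M: "M \<subseteq> edges (two_cliques N A)" "disjoint M" "\<Union>M = {1..N}"
    by (auto simp: has_perfect_matching_def)
  have card: "card e = 2" if "e \<in> M" for e
    using that M(1) edges_two_cliques_subset by (auto simp: potential_edges_def)
  have "e \<subseteq> A \<or> e \<inter> A = {}" if "e \<in> M" for e
    using that M(1) edges_two_cliques_subset edges_two_cliques_iff by blast
  then have "\<Union>{e\<in>M. e \<subseteq> A} = A"
    using assms(1) M(3) by blast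
  moreover have "even (card (\<Union>{e\<in>M. e \<subseteq> A}))"
    using M(2) card by (intro even_card_Union_of_pairs) (auto simp: pairwise_def)
  moreover have "even N"
    using even_card_Union_of_pairs[OF M(2) card] M(3) by simp
  ultimately show False using assms(2) by simp
qed

(* For N = 2 and N = 4 the odd cuts do not give pairwise independent edges. *)
definition cuts :: "nat \<Rightarrow> nat set set" where
  "cuts N = {A. A \<subseteq> {1..N} \<and> (even N \<and> N \<ge> 6 \<longrightarrow> odd (card A))}"

lemma finite_cuts [simp]: "finite (cuts N)"
  by (simp add: cuts_def)

lemma cuts_nonempty [simp]: "cuts N \<noteq> {}"
proof -
  \<comment> \<open>The witness is \<open>{1}\<close>, of odd size, for N \<ge> 1; the intersection
    turns it into the empty set for N = 0.\<close>
  have "{1..N} \<inter> {1} \<in> cuts N"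
    by (auto simp: cuts_def)
  then show ?thesis by blast
qed

section \<open>Flips of cuts\<close>

lemma odd_card_sym_diff_singleton:
  assumes "finite A"
  shows "odd (card (sym_diff A {v})) \<longleftrightarrow> even (card A)"
proof (cases "v \<in> A")
  case True
  then have "sym_diff A {v} = A - {v}" by auto
  moreover have "card A = Suc (card (A - {v}))"
    using True assms by (metis card_Suc_Diff1)
  ultimately show ?thesis by simp
next
  case False
  then have "sym_diff A {v} = insert v A" by auto
  then show ?thesis using False assms by simp
qed

text \<open>In the applications \<open>R\<close> is the other edge, whose presence the flip must not
  change, or empty when only one edge matters.\<close>

lemma obtain_cut_flip:
  assumes e: "e \<in> potential_edges N" and R: "card R \<le> 2" "finite R" "\<not> e \<subseteq> R"
  obtains T where "card (e \<inter> T) = 1" "R \<inter> T = {}" "\<And>A. A \<in> cuts N \<Longrightarrow> sym_diff A T \<in> cuts N"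
proof -
  obtain v where v: "v \<in> e" "v \<notin> R" "v \<in> {1..N}"
    using e R unfolding potential_edges_def by blast
  show ?thesis
  proof (cases "even N \<and> N \<ge> 6")
    case False
    then show ?thesis using v by (intro that[of "{v}"]) (auto simp: cuts_def)
  next
    case True
    have "card e = 2" "finite e"
      using e by (auto simp: potential_edges_def intro: card_ge_0_finite)
    \<comment> \<open>The bound N \<ge> 6 leaves a vertex \<open>w\<close> outside \<open>e\<close>
      and \<open>R\<close>; moving it together with \<open>v\<close> restores the parity of the
      cut.\<close>
    then have "card (e \<union> R) \<le> 4"
      using R card_Un_le[of e R] by simp
    then have "\<not> {1..N} \<subseteq> e \<union> R"
      using True R(2) \<open>finite e\<close> card_mono[of "e \<union> R" "{1..N}"] by auto
    then obtain w where w: "w \<in> {1..N}" "w \<notin> e" "w \<notin> R" by blast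
    have "sym_diff A {v, w} \<in> cuts N" if "A \<in> cuts N" for A
    proof -
      have "v \<noteq> w" using v w by blast
      then have "sym_diff A {v, w} = sym_diff (sym_diff A {v}) {w}" by blast
      moreover have "finite A" "odd (card A)"
        using that True by (auto simp: cuts_def intro: finite_subset)
      ultimately have "odd (card (sym_diff A {v, w}))"
        using odd_card_sym_diff_singleton[of "sym_diff A {v}" w] odd_card_sym_diff_singleton[of A v]
        by simp
      then show ?thesis using that v w by (auto simp: cuts_def)
    qed
    moreover have "e \<inter> {v, w} = {v}" using v w by blast
    ultimately show ?thesis using v w by (intro that[of "{v, w}"]) auto
  qed
qed

text \<open>Exactly one endpoint of \<open>e\<close> changes sides, so endpoints on the same side
  become separated and vice versa.\<close>

lemma edges_flip:
  assumes e: "e \<in> potential_edges N" and T: "card (e \<inter> T) = 1"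
  shows "e \<in> edges (two_cliques N (sym_diff A T)) \<longleftrightarrow> e \<notin> edges (two_cliques N A)"
proof -
  obtain v where v: "e \<inter> T = {v}" using T card_1_singletonE by blast
  have "card e = 2" using e by (simp add: potential_edges_def)
  then have "card (e - {v}) = 1"
    using v by (subst card_Diff_singleton) auto
  then obtain w where "e - {v} = {w}"
    using card_1_singletonE by blast
  then have "e = {v, w}" "v \<noteq> w"
    using v by auto
  then show ?thesis
    using v unfolding edges_two_cliques_iff[OF e] by auto
qed

lemma edges_unflipped:
  assumes "e \<in> potential_edges N" "e \<inter> T = {}"
  shows "e \<in> edges (two_cliques N (sym_diff A T)) \<longleftrightarrow> e \<in> edges (two_cliques N A)"
  using assms(2) unfolding edges_two_cliques_iff[OF assms(1)] by blast

section \<open>The random graph of a uniform cut\<close>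

definition cut_graph :: "nat \<Rightarrow> nat pair_pre_digraph pmf" where
  "cut_graph N = map_pmf (two_cliques N) (pmf_of_set (cuts N))"

lemma prob_cut_graph:
  "measure_pmf.prob (cut_graph N) {H. P H} =
     measure_pmf.prob (pmf_of_set (cuts N)) {A. P (two_cliques N A)}"
  by (simp add: cut_graph_def vimage_def)

text \<open>This gives both facts about edges: \<open>Q\<close> trivial with \<open>R\<close> empty
  yields probability 1/2, and \<open>Q\<close> the presence of another edge \<open>R\<close> yields
  the product rule.\<close>

lemma prob_edge_cut_graph:
  assumes e: "e \<in> potential_edges N" and R: "card R \<le> 2" "finite R" "\<not> e \<subseteq> R"
    and Q: "\<And>A T. R \<inter> T = {} \<Longrightarrow> Q (two_cliques N (sym_diff A T)) \<longleftrightarrow> Q (two_cliques N A)"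
  shows "measure_pmf.prob (cut_graph N) {H. e \<in> edges H \<and> Q H} =
    measure_pmf.prob (cut_graph N) {H. Q H} / 2"
proof -
  obtain T where T: "card (e \<inter> T) = 1" "R \<inter> T = {}"
      "\<And>A. A \<in> cuts N \<Longrightarrow> sym_diff A T \<in> cuts N"
    using obtain_cut_flip[OF e R] by blast
  \<comment> \<open>The flip is its own inverse, hence permutes the cuts and preserves the uniform
    distribution.\<close>
  have "sym_diff (sym_diff A T) T = A" for A by blast
  then have "bij_betw (\<lambda>A. sym_diff A T) (cuts N) (cuts N)"
    using T(3) by (intro bij_betw_byWitness[where f' = "\<lambda>A. sym_diff A T"]) auto
  then have "map_pmf (\<lambda>A. sym_diff A T) (pmf_of_set (cuts N)) = pmf_of_set (cuts N)"
    by (intro map_pmf_of_set_bij_betw) auto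
  then show ?thesis
    unfolding prob_cut_graph by (rule prob_flip) (use edges_flip[OF e T(1)] Q[OF T(2)] in auto)
qed

lemma cut_graph_pairwise_independent:
  "kwise_independent_random_graph (\<lambda>_. 2) (\<lambda>_. 1/2) cut_graph"
proof -
  have half: "measure_pmf.prob (cut_graph N) {H. e \<in> edges H} = 1/2"
    if "e \<in> potential_edges N" for e N
  proof -
    have "\<not> e \<subseteq> {}" using that by (auto simp: potential_edges_def)
    then show ?thesis
      using prob_edge_cut_graph[OF that, of "{}" "\<lambda>_. True"]
      by (simp add: measure_pmf.prob_space[simplified])
  qed
  have indep: "prob_space.indep_vars (measure_pmf (cut_graph N)) (\<lambda>_. count_space (UNIV :: bool set))
      (\<lambda>e H. e \<in> edges H) S" if S: "S \<subseteq> potential_edges N" "card S = 2" for S N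
  proof -
    obtain d e where de: "S = {d, e}" "d \<noteq> e"
      using S by (auto simp: card_2_iff)
    then have pot: "d \<in> potential_edges N" "e \<in> potential_edges N" using S by auto
    then have c: "card d = 2" "card e = 2" "finite d" "finite e"
      by (auto simp: potential_edges_def intro: card_ge_0_finite)
    \<comment> \<open>Distinct edges of equal size are not nested, so \<open>d\<close> has a vertex
      outside \<open>e\<close> to flip.\<close>
    have "\<not> d \<subseteq> e" using c de by (metis card_subset_eq)
    then have "measure_pmf.prob (cut_graph N) {H. d \<in> edges H \<and> e \<in> edges H} =
        measure_pmf.prob (cut_graph N) {H. e \<in> edges H} / 2"
      using c by (intro prob_edge_cut_graph[OF pot(1)]) (auto simp only: edges_unflipped[OF pot(2)])
    also have "\<dots> = measure_pmf.prob (cut_graph N) {H. d \<in> edges H} *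
        measure_pmf.prob (cut_graph N) {H. e \<in> edges H}"
      by (simp add: half[OF pot(1)] half[OF pot(2)])
    finally show ?thesis
      unfolding de(1) by (rule indep_vars_bool_pairI[OF de(2)])
  qed
  have "pair_graph H \<and> pverts H = {1..N}" if "H \<in> set_pmf (cut_graph N)" for H N
    using that by (auto simp: cut_graph_def pair_graph_two_cliques)
  with half indep show ?thesis
    unfolding kwise_independent_random_graph_def by blast
qed

text \<open>Only the two trivial cuts can give a connected graph. For even N their sizes 0 and N
  have the wrong parity; for odd N they are 2 among 2^N equally likely cuts.\<close>

lemma prob_cut_graph_disconnected_ge:
  assumes "N \<ge> 6"
  shows "measure_pmf.prob (cut_graph N) {H. \<not> Digraph_Component.connected (with_proj H)}
    \<ge> 1 - 2 / 2 ^ N"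
proof -
  let ?B = "cuts N \<inter> {{}, {1..N}}"
  let ?P = "measure_pmf.prob (pmf_of_set (cuts N))"
  have "?P {{}, {1..N}} = card ?B / card (cuts N)"
    by (simp add: measure_pmf_of_set)
  also have "\<dots> \<le> 2 / 2 ^ N"
  proof (cases "even N")
    case True
    then have "?B = {}" using assms by (auto simp: cuts_def)
    then show ?thesis by (simp only:) simp
  next
    case False
    then have "cuts N = Pow {1..N}" by (auto simp: cuts_def)
    then have "card (cuts N) = 2 ^ N" by (simp add: card_Pow)
    moreover have "card ?B \<le> card {{}, {1..N}}" by (intro card_mono) auto
    then have "card ?B \<le> 2" using card_insert_le_m1[of 2 "{{1..N}}" "{}"] by simp
    ultimately show ?thesis by (simp add: divide_right_mono)
  qed
  finally have "1 - 2 / 2 ^ N \<le> ?P (- {{}, {1..N}})"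
    using measure_pmf.prob_compl[of "{{}, {1..N}}" "pmf_of_set (cuts N)"]
    by (simp add: Compl_eq_Diff_UNIV)
  moreover have "\<not> Digraph_Component.connected (with_proj (two_cliques N A))"
    if "A \<in> cuts N" "A \<notin> {{}, {1..N}}" for A
    using that not_connected_two_cliques[of A N] by (simp add: cuts_def)
  then have "?P (- {{}, {1..N}}) \<le> ?P {A. \<not> Digraph_Component.connected (with_proj (two_cliques N A))}"
    by (intro measure_pmf.finite_measure_mono_AE) (auto simp: AE_measure_pmf_iff)
  ultimately show ?thesis unfolding prob_cut_graph by linarith
qed

theorem mainTheorem4:
  shows "\<exists>G :: nat \<Rightarrow> nat pair_pre_digraph pmf.
    kwise_independent_random_graph (\<lambda>_. 2) (\<lambda>_. 1/2) G \<and>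
    (\<lambda>N. measure_pmf.prob (G N) {H. \<not> Digraph_Component.connected (with_proj H)}) \<longlonglongrightarrow> 1 \<and>
    (\<lambda>N. measure_pmf.prob (G N) {H. \<not> has_hamiltonian_cycle H}) \<longlonglongrightarrow> 1 \<and>
    (\<forall>N\<ge>1. N \<notin> {2, 4} \<longrightarrow>
       measure_pmf.prob (G N) {H. \<not> has_perfect_matching H} = 1)"
proof (intro exI conjI allI impI)
  let ?D = "\<lambda>N. measure_pmf.prob (cut_graph N) {H. \<not> Digraph_Component.connected (with_proj H)}"
  let ?C = "\<lambda>N. measure_pmf.prob (cut_graph N) {H. \<not> has_hamiltonian_cycle H}"
  show "kwise_independent_random_graph (\<lambda>_. 2) (\<lambda>_. 1/2) cut_graph"
    by (rule cut_graph_pairwise_independent)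
  have "(\<lambda>N. 1 - 2 / 2 ^ N :: real) \<longlonglongrightarrow> 1"
    by real_asymp
  then show D: "?D \<longlonglongrightarrow> 1"
    by (rule tendsto_sandwich[rotated 2])
      (auto intro!: eventually_sequentiallyI[of 6] prob_cut_graph_disconnected_ge)
  \<comment> \<open>A disconnected graph has no Hamiltonian cycle, so the second limit follows from
    the first.\<close>
  have "?D N \<le> ?C N" for N
    using hamiltonian_cycle_imp_connected pair_graph_two_cliques
    by (intro measure_pmf.finite_measure_mono_AE) (auto simp: AE_measure_pmf_iff cut_graph_def)
  then show "?C \<longlonglongrightarrow> 1"
    by (intro tendsto_sandwich[OF _ _ D tendsto_const]) auto
  fix N :: nat
  assume N: "N \<ge> 1" "N \<notin> {2, 4}"
  have "\<not> has_perfect_matching (two_cliques N A)" if "A \<in> cuts N" for A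
  proof (rule no_perfect_matching_two_cliques)
    show "A \<subseteq> {1..N}" using that by (simp add: cuts_def)
    \<comment> \<open>Once 2 and 4 are excluded, every positive even N is at least 6, so its cuts
      have odd size; an odd N rules out a perfect matching by itself.\<close>
    have "odd N \<or> even N \<and> N \<ge> 6" using N by (cases "odd N") (auto simp: not_le elim!: evenE)
    then show "odd (card A) \<or> odd N" using that by (auto simp: cuts_def)
  qed
  then show "measure_pmf.prob (cut_graph N) {H. \<not> has_perfect_matching H} = 1"
    by (subst measure_pmf.prob_eq_1) (auto simp: AE_measure_pmf_iff cut_graph_def)
qed

end
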